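(* Let $q,w_0,w_1\in\mathbb{C}$. Define sequences $(V_j)_{j\ge0}$ and $(W_j)_{j\ge 0}$ by $V_0=2$, $V_1=1$, $V_{j+2}=V_{j+1}-qV_j$, and $W_0=w_0$, $W_1=w_1$, $W_{j+2}=W_{j+1}-qW_j$. Put $$h=1-q,\qquad a_j=W_{2j}+W_j-w_0V_j\quad(j\ge 0).$$ Then for every even integer $N\ge 2$, $$\sum_{j=0}^{N}\binom{N}{j}h^{N-j}B_{N-j}a_j=0,$$ and consequently, for every even integer $N\ge 4$, $$N\sum_{j=1}^{N-2}\binom{N-1}{j}h^{N-j}a_j\,\zeta(j+1-N)=a_N-\frac{Nh}{2}a_{N-1}.$$ Both identities hold in particular at $q=1/4$ (where the roots of $t^2-t+q$ coincide) and at $q=1$ (where $h=0$).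
   Context: The Bernoulli numbers $B_m$ are defined by $\frac{z}{e^z-1}=\sum_{m\ge0}B_m\frac{z^m}{m!}$, so $B_0=1$ and $B_1=-\tfrac12$. $\zeta$ denotes the Riemann zeta function (meromorphically continued). A zeroth power equals $1$, including $0^0=1$. *)

theory Defs
  imports
    "HOL-Computational_Algebra.Computational_Algebra"
    "HOL-Complex_Analysis.Complex_Analysis"
begin

text \<open>
  The quotient is taken in the ring of formal power series: the divisor has no constant term,
  but neither has the dividend, so the quotient is exact.
\<close>

definition bernoulli_number :: "nat \<Rightarrow> complex" where
  "bernoulli_number m = fact m * fps_nth (fps_X / (fps_exp 1 - 1)) m"

lemma fps_X_div_exp_minus_1:
  "(fps_X / (fps_exp 1 - 1)) * (fps_exp 1 - 1) = (fps_X :: complex fps)"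
proof -
  let ?E = "fps_exp 1 - 1 :: complex fps"
  have nz: "fps_nth ?E 1 \<noteq> 0" by simp
  hence "?E \<noteq> 0" by (metis fps_zero_nth)
  moreover have "subdegree ?E = 1"
    by (rule subdegreeI) (use nz in auto)
  ultimately have "?E dvd fps_X"
    by (simp add: fps_dvd_iff)
  thus ?thesis by simp
qed

lemma bernoulli_number_0: "bernoulli_number 0 = 1"
  and bernoulli_number_1: "bernoulli_number 1 = - 1 / 2"
proof -
  define Q where "Q = (fps_X / (fps_exp 1 - 1) :: complex fps)"
  have Q: "Q * (fps_exp 1 - 1) = fps_X"
    unfolding Q_def by (rule fps_X_div_exp_minus_1)
  have 0: "fps_nth Q 0 = 1"
    using arg_cong[OF Q, of "\<lambda>f. fps_nth f 1"] by (simp add: fps_mult_nth)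
  have "fps_nth Q 0 / 2 + fps_nth Q 1 = 0"
    using arg_cong[OF Q, of "\<lambda>f. fps_nth f 2"]
    by (simp add: fps_mult_nth numeral_2_eq_2)
  with 0 have 1: "fps_nth Q 1 = - 1 / 2"
    by (simp add: field_simps add_eq_0_iff)
  show "bernoulli_number 0 = 1" "bernoulli_number 1 = - 1 / 2"
    using 0 1 unfolding bernoulli_number_def Q_def by simp_all
qed

text \<open>
  The analytic continuation of the Dirichlet series to the plane punctured at the pole.
  The value at the pole itself is unspecified.
\<close>

definition is_zeta_continuation :: "(complex \<Rightarrow> complex) \<Rightarrow> bool" where
  "is_zeta_continuation f \<longleftrightarrow>
     f holomorphic_on (- {1}) \<and>
     (\<forall>s. Re s > 1 \<longrightarrow> (\<lambda>n. of_nat (Suc n) powr (- s)) sums f s)"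

definition riemann_zeta :: "complex \<Rightarrow> complex" where
  "riemann_zeta = (SOME f. is_zeta_continuation f)"

lemma is_zeta_continuation_unique:
  assumes "is_zeta_continuation f" "is_zeta_continuation g" "s \<noteq> 1"
  shows "f s = g s"
proof (rule analytic_continuation_open[where f = f and g = g])
  show "open {s. Re s > 1}" by (rule open_halfspace_Re_gt)
  show "{s. Re s > 1} \<noteq> {}" by (auto intro: exI[of _ 2])
  show "connected (- {1 :: complex})"
    by (rule connected_punctured_universe) simp
  show "{s. Re s > 1} \<subseteq> - {1}" by auto
  show "f z = g z" if "z \<in> {s. Re s > 1}" for z
    using assms(1,2) that by (auto simp: is_zeta_continuation_def intro: sums_unique2)
qed (use assms in \<open>auto simp: is_zeta_continuation_def\<close>)

end

theory Submission
  imports Defs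
begin

text \<open>
  Let \<open>L\<close> be the linear functional on polynomials with \<open>L (x ^ j) = W j\<close>. It vanishes on the
  multiples of \<open>m = x\<^sup>2 - x + q\<close>, and modulo \<open>m\<close> we have \<open>V j = x ^ j + (1 - x) ^ j\<close>, so that
  \<open>a j = L ((x\<^sup>2) ^ j - (1 - x) ^ j)\<close>. Since \<open>x\<^sup>2 \<equiv> h - (1 - x)\<close> modulo \<open>m\<close>, the first identity is the
  reflection symmetry \<open>B N (h - y) = B N y\<close>, for even \<open>N\<close>, of the homogenised Bernoulli polynomial.
  Working modulo \<open>m\<close> instead of with its roots makes a double root harmless.

  The second identity follows with \<open>\<zeta>(-m) = - B (m + 1) / (m + 1)\<close>. The continuation of \<open>\<zeta>\<close> to
  \<open>Re s > 1 - M\<close> comes from subtracting the increments of the \<open>M\<close>-th order Euler-Maclaurin primitive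
  of \<open>x powr (-s)\<close> termwise; at \<open>s = -m\<close> this primitive is exact for \<open>M > m\<close>, and only its value at 1 remains.
\<close>

section \<open>Bernoulli polynomials through their generating function\<close>

abbreviation (input) bernoulli_fps :: "complex fps" where
  "bernoulli_fps \<equiv> fps_X / (fps_exp 1 - 1)"

text \<open>This is the Bernoulli polynomial \<open>B_k(t)\<close> divided by \<open>k!\<close>, a
  normalisation under which differentiation in \<open>t\<close> just lowers the index.\<close>

definition bernpoly_egf_coeff :: "nat \<Rightarrow> complex \<Rightarrow> complex" where
  "bernpoly_egf_coeff k t = fps_nth (bernoulli_fps * fps_exp t) k"

lemma bernpoly_egf_coeff_0: "bernpoly_egf_coeff k 0 = bernoulli_number k / fact k"
  by (simp add: bernpoly_egf_coeff_def bernoulli_number_def)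

lemma bernpoly_egf_coeff_zeroth [simp]: "bernpoly_egf_coeff 0 t = 1"
  using bernoulli_number_0 by (simp add: bernpoly_egf_coeff_def bernoulli_number_def)

text \<open>Multiplying the series by \<open>e^z - 1\<close> gives \<open>z\<close>, so only
  coefficient 1 jumps between 0 and 1. In Euler-Maclaurin summation this jump produces the summand
  itself.\<close>

lemma bernpoly_egf_coeff_1:
  "bernpoly_egf_coeff k 1 = bernpoly_egf_coeff k 0 + (if k = 1 then 1 else 0)"
proof -
  have "bernoulli_fps * fps_exp 1 = bernoulli_fps * fps_exp 0 + fps_X"
    using fps_X_div_exp_minus_1 by (simp add: algebra_simps)
  thus ?thesis by (simp add: bernpoly_egf_coeff_def del: fps_exp_0)
qed

lemma bernpoly_egf_coeff_deriv:
  "(bernpoly_egf_coeff (Suc k) has_field_derivative bernpoly_egf_coeff k t) (at t)"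
proof -
  let ?\<beta> = "fps_nth bernoulli_fps"
  have "((\<lambda>t. \<Sum>i\<le>Suc k. ?\<beta> (Suc k - i) * (t ^ i / fact i)) has_field_derivative
          (\<Sum>i\<le>k. ?\<beta> (k - i) * (t ^ i / fact i))) (at t)"
    unfolding sum.atMost_Suc_shift diff_Suc_Suc
  proof (rule DERIV_cong)
    have "((\<lambda>t. t ^ Suc i / fact (Suc i)) has_field_derivative t ^ i / fact i) (at t)" for i
    proof -
      have "((\<lambda>t. t ^ Suc i) has_field_derivative of_nat (Suc i) * t ^ i) (at t)"
        using DERIV_power[OF DERIV_ident, where n = "Suc i"] by simp
      from DERIV_cdivide[OF this, of "fact (Suc i)"] show ?thesis
        by (simp del: of_nat_Suc power_Suc)
    qed
    thus "((\<lambda>t. ?\<beta> (Suc k - 0) * (t ^ 0 / fact 0) +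
             (\<Sum>i\<le>k. ?\<beta> (k - i) * (t ^ Suc i / fact (Suc i)))) has_field_derivative
           0 + (\<Sum>i\<le>k. ?\<beta> (k - i) * (t ^ i / fact i))) (at t)"
      by (intro DERIV_add DERIV_sum DERIV_cmult) auto
  qed simp
  moreover have "bernpoly_egf_coeff n t = (\<Sum>i\<le>n. ?\<beta> (n - i) * (t ^ i / fact i))" for n t
    unfolding bernpoly_egf_coeff_def
    by (subst mult.commute, simp add: fps_mult_nth atLeast0AtMost mult.commute)
  ultimately show ?thesis by presburger
qed

section \<open>Reflection symmetry of the homogenised Bernoulli polynomials\<close>

lemma bernoulli_fps_mult_exp:
  "bernoulli_fps * fps_exp 1 = bernoulli_fps oo (- fps_X)"
proof -
  let ?E = "fps_exp 1 :: complex fps"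
  have E: "?E oo (- fps_X) = fps_exp (-1)"
    using fps_exp_compose_linear[of 1 "-1::complex"] by (simp add: fps_const_neg[symmetric])
  \<comment> \<open>Clear denominators: each side times \<open>?E - 1\<close> equals
    \<open>z e^z\<close>, and this nonzero factor can then be cancelled.\<close>
  have "(bernoulli_fps * (?E - 1)) oo (-fps_X) = - fps_X"
    by (subst fps_X_div_exp_minus_1) simp
  hence "(bernoulli_fps oo (-fps_X)) * (fps_exp (-1) - 1) = - fps_X"
    by (simp add: fps_compose_mult_distrib fps_compose_sub_distrib E)
  hence "(bernoulli_fps oo (-fps_X)) * (fps_exp (-1) - 1) * ?E = - fps_X * ?E" by simp
  moreover have "fps_exp (-1) * ?E = 1" by (simp flip: fps_exp_add_mult)
  hence "(fps_exp (-1) - 1) * ?E = - (?E - 1)" by (simp add: algebra_simps)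
  ultimately have "(bernoulli_fps oo (-fps_X)) * (?E - 1) = fps_X * ?E"
    by (simp only: mult.assoc mult_minus_left mult_minus_right neg_equal_iff_equal)
  also have "\<dots> = bernoulli_fps * (?E - 1) * ?E"
    by (simp only: fps_X_div_exp_minus_1)
  also have "\<dots> = (bernoulli_fps * ?E) * (?E - 1)"
    by (simp only: mult_ac)
  finally have "(bernoulli_fps oo (-fps_X)) * (?E - 1) = (bernoulli_fps * ?E) * (?E - 1)" .
  moreover have "?E - 1 \<noteq> 0"
    using fps_X_div_exp_minus_1 by fastforce
  ultimately show ?thesis by simp
qed

text \<open>For nonzero \<open>h\<close> this is \<open>h^N B_N(y/h)\<close>; the expanded form
  avoids the division and gives \<open>y^N\<close> at \<open>h = 0\<close>.\<close>

definition scaled_bernpoly :: "nat \<Rightarrow> complex \<Rightarrow> complex \<Rightarrow> complex" where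
  "scaled_bernpoly N h y =
     (\<Sum>j=0..N. of_nat (N choose j) * h ^ (N - j) * bernoulli_number (N - j) * y ^ j)"

lemma scaled_bernpoly_egf:
  "scaled_bernpoly N h y =
     fact N * fps_nth ((bernoulli_fps oo (fps_const h * fps_X)) * fps_exp y) N"
proof -
  define F where "F = bernoulli_fps oo (fps_const h * fps_X)"
  have F: "fps_nth F k = h ^ k * bernoulli_number k / fact k" for k
    by (simp add: F_def fps_compose_linear bernoulli_number_def)
  have "scaled_bernpoly N h y = fact N * fps_nth (fps_exp y * F) N"
    unfolding scaled_bernpoly_def fps_mult_nth sum_distrib_left
    by (rule sum.cong) (auto simp: F binomial_fact)
  thus ?thesis by (simp only: F_def mult.commute)
qed

text \<open>Replacing \<open>y\<close> by \<open>h - y\<close> substitutes \<open>-z\<close> for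
  \<open>z\<close> in the generating function, which leaves even coefficients unchanged.\<close>

lemma scaled_bernpoly_reflect:
  assumes "even N"
  shows "scaled_bernpoly N h (h - y) = scaled_bernpoly N h y"
proof -
  let ?hX = "fps_const h * fps_X" and ?Q = "bernoulli_fps"
  \<comment> \<open>Transfer the symmetry from \<open>h = 1\<close> to general \<open>h\<close>: the
    substitutions \<open>-z\<close> and \<open>h z\<close> commute.\<close>
  have "(?Q * fps_exp 1) oo ?hX = (?Q oo - fps_X) oo ?hX"
    by (simp only: bernoulli_fps_mult_exp)
  also have "\<dots> = ?Q oo ((- fps_X) oo ?hX)"
    by (rule fps_compose_assoc [symmetric]) auto
  also have "(- fps_X) oo ?hX = ?hX oo (fps_const (- 1) * fps_X)"
    by (simp add: fps_compose_mult_distrib fps_const_neg[symmetric] fps_compose_uminus del: fps_const_neg)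
  also have "?Q oo \<dots> = (?Q oo ?hX) oo (fps_const (- 1) * fps_X)"
    by (rule fps_compose_assoc) auto
  finally have 1: "(?Q oo ?hX) * fps_exp h = (?Q oo ?hX) oo (fps_const (- 1) * fps_X)"
    by (simp add: fps_compose_mult_distrib fps_exp_compose_linear)
  have "(?Q oo ?hX) * fps_exp (h - y) = (?Q oo ?hX) * fps_exp h * fps_exp (- y)"
    by (simp add: mult.assoc flip: fps_exp_add_mult)
  also have "\<dots> = ((?Q oo ?hX) * fps_exp y) oo (fps_const (- 1) * fps_X)"
    unfolding 1 by (simp add: fps_compose_mult_distrib fps_exp_compose_linear del: fps_const_neg)
  finally show ?thesis using assms
    by (simp add: scaled_bernpoly_egf fps_compose_linear del: fps_const_neg)
qed

section \<open>The linear functional of a recurrence sequence\<close>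

definition seq_functional :: "(nat \<Rightarrow> complex) \<Rightarrow> complex poly \<Rightarrow> complex" where
  "seq_functional W p = (\<Sum>i\<le>degree p. coeff p i * W i)"

text \<open>A common degree bound lets linearity be checked coefficientwise, even where leading
  terms cancel.\<close>

lemma seq_functional_altdef:
  "degree p \<le> n \<Longrightarrow> seq_functional W p = (\<Sum>i\<le>n. coeff p i * W i)"
  unfolding seq_functional_def
  by (rule sum.mono_neutral_left) (auto simp: coeff_eq_0)

lemma seq_functional_add: "seq_functional W (p + r) = seq_functional W p + seq_functional W r"
  using degree_add_le_max[of p r]
  by (simp add: seq_functional_altdef[of _ "max (degree p) (degree r)"] ring_distribs sum.distrib)

lemma seq_functional_smult: "seq_functional W (smult c p) = c * seq_functional W p"
  using degree_smult_le[of c p]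
  by (simp add: seq_functional_altdef[of _ "degree p"] sum_distrib_left mult_ac)

lemma seq_functional_diff: "seq_functional W (p - r) = seq_functional W p - seq_functional W r"
  using seq_functional_add[of W "p - r" r] by simp

lemma seq_functional_0 [simp]: "seq_functional W 0 = 0"
  by (simp add: seq_functional_def)

lemma seq_functional_sum: "seq_functional W (\<Sum>i\<in>A. f i) = (\<Sum>i\<in>A. seq_functional W (f i))"
  by (induction A rule: infinite_finite_induct) (auto simp: seq_functional_add)

lemma seq_functional_monom: "seq_functional W (monom c n) = c * W n"
proof -
  have "seq_functional W (monom c n) = (\<Sum>i\<le>n. coeff (monom c n) i * W i)"
    by (rule seq_functional_altdef) (rule degree_monom_le)
  also have "\<dots> = (\<Sum>i\<in>{n}. coeff (monom c n) i * W i)"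
    by (rule sum.mono_neutral_right) auto
  finally show ?thesis by simp
qed

text \<open>On the characteristic polynomial times a monomial the functional returns a multiple of
  the recurrence, hence 0; general multiples are sums of these.\<close>

lemma seq_functional_char_poly_dvd:
  assumes rec: "\<And>j. W (j + 2) = W (j + 1) - q * W j" and "[:q, -1, 1:] dvd p"
  shows "seq_functional W p = 0"
proof -
  have "seq_functional W ([:q, -1, 1:] * r) = 0" for r
  proof -
    have *: "[:q, -1, 1:] * monom c n = monom c (n + 2) - monom c (n + 1) + smult q (monom c n)" for c n
      by (simp add: monom_Suc poly_eq_iff coeff_pCons split: nat.split)
    have "seq_functional W ([:q, -1, 1:] * monom c n) = 0" for c n
      unfolding * using rec[of n, THEN arg_cong, of "\<lambda>z. c * z"]
      by (simp add: seq_functional_add seq_functional_diff seq_functional_smult seq_functional_monom algebra_simps)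
    moreover have "[:q, -1, 1:] * r = (\<Sum>i\<le>degree r. [:q, -1, 1:] * monom (coeff r i) i)"
      by (subst poly_as_sum_of_monoms[of r, symmetric]) (simp add: sum_distrib_left del: mult_pCons_left)
    ultimately show ?thesis by (simp add: seq_functional_sum del: mult_pCons_left)
  qed
  thus ?thesis using assms(2) by (elim dvdE) simp
qed

text \<open>Modulo the characteristic polynomial both \<open>x\<close> and \<open>1 - x\<close>
  satisfy \<open>t^2 = t - q\<close>, so their power sums obey the recurrence of \<open>V\<close>
  and share its initial values.\<close>

lemma char_poly_dvd_power_sum:
  fixes q :: complex
  assumes "V 0 = 2" "V 1 = 1" "\<And>j. V (j + 2) = V (j + 1) - q * V j"
  shows "[:q, -1, 1:] dvd [:0, 1:] ^ j + [:1, -1:] ^ j - [:V j:]"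
proof (induction j rule: induct_nat_012)
  case 0
  show ?case using assms(1) by (simp add: numeral_poly one_pCons)
next
  case 1
  show ?case using assms(2) by simp
next
  case (ge2 n)
  let ?m = "[:q, -1, 1:]" and ?x = "[:0, 1:] :: complex poly" and ?y = "[:1, -1:] :: complex poly"
  have xx: "?x * ?x = ?x - [:q:] + ?m" and yy: "?y * ?y = ?y - [:q:] + ?m" by simp_all
  have V: "[:V (Suc (Suc n)):] = [:V (Suc n):] - [:q:] * [:V n:]"
    using assms(3)[of n] by simp
  have "?x ^ Suc (Suc n) + ?y ^ Suc (Suc n) = (?x * ?x) * ?x ^ n + (?y * ?y) * ?y ^ n"
    by (simp only: power_Suc mult.assoc)
  also have "\<dots> - [:V (Suc (Suc n)):] =
      (?x ^ Suc n + ?y ^ Suc n - [:V (Suc n):]) - [:q:] * (?x ^ n + ?y ^ n - [:V n:])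
       + ?m * (?x ^ n + ?y ^ n)"
    unfolding xx yy V power_Suc by (simp only: algebra_simps)
  finally show ?case by (simp only:) (intro dvd_add dvd_diff dvd_mult dvd_triv_left ge2)
qed

section \<open>The Bernoulli number identity\<close>

lemma sum_bernoulli_eq_0:
  fixes q w0 h :: complex and V W a :: "nat \<Rightarrow> complex"
  assumes V: "V 0 = 2" "V 1 = 1" "\<And>j. V (j + 2) = V (j + 1) - q * V j"
    and W: "W 0 = w0" "\<And>j. W (j + 2) = W (j + 1) - q * W j"
    and h: "h = 1 - q"
    and a: "\<And>j. a j = W (2 * j) + W j - w0 * V j"
    and N: "even N"
  shows "(\<Sum>j=0..N. of_nat (N choose j) * h ^ (N - j) * bernoulli_number (N - j) * a j) = 0"
proof -
  let ?m = "[:q, -1, 1:]" and ?x = "[:0, 1:] :: complex poly" and ?y = "[:1, -1:] :: complex poly"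
  define c where "c j = of_nat (N choose j) * h ^ (N - j) * bernoulli_number (N - j)" for j
  define H where "H p = (\<Sum>j=0..N. smult (c j) (p ^ j))" for p :: "complex poly"
  \<comment> \<open>Applying the functional to the power sum relation turns
    \<open>W j - w0 * V j\<close> into minus the value at \<open>?y ^ j\<close>, because
    \<open>w0\<close> is the value at 1.\<close>
  have aj: "a j = seq_functional W ((?x\<^sup>2) ^ j - ?y ^ j)" for j
  proof -
    have "seq_functional W (?x ^ j + ?y ^ j - [:V j:]) = 0"
      using char_poly_dvd_power_sum[OF V] seq_functional_char_poly_dvd W(2) by blast
    hence "seq_functional W (?y ^ j) = V j * w0 - W j"
      using seq_functional_monom[of W 1 j] seq_functional_monom[of W "V j" 0] W(1)
      by (simp add: seq_functional_add seq_functional_diff monom_altdef algebra_simps)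
    moreover have "seq_functional W ((?x\<^sup>2) ^ j) = W (2 * j)"
      using seq_functional_monom[of W 1 "2 * j"] by (simp only: power_mult monom_altdef) simp
    ultimately show ?thesis by (simp add: a seq_functional_diff)
  qed
  have "(\<Sum>j=0..N. c j * a j) = seq_functional W (H (?x\<^sup>2) - H ?y)"
    by (simp add: aj H_def seq_functional_sum seq_functional_diff seq_functional_smult
        sum_subtractf algebra_simps)
  \<comment> \<open>Reflection holds at every complex point, hence as an exact polynomial identity;
    reduction modulo \<open>?m\<close> comes only afterwards.\<close>
  also have "H (?x\<^sup>2) = H ([:h:] - ?x\<^sup>2)"
  proof -
    have "poly (H p) z = scaled_bernpoly N h (poly p z)" for p z
      by (simp add: H_def c_def scaled_bernpoly_def poly_sum)
    thus ?thesis
      by (simp flip: poly_eq_poly_eq_iff add: fun_eq_iff scaled_bernpoly_reflect[OF N])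
  qed
  also have "seq_functional W (H ([:h:] - ?x\<^sup>2) - H ?y) = 0"
  proof (rule seq_functional_char_poly_dvd)
    \<comment> \<open>This is where \<open>h = 1 - q\<close> enters: the two arguments of
      \<open>H\<close> are congruent modulo \<open>?m\<close>, hence so are all their
      powers.\<close>
    have "[:h:] - ?x\<^sup>2 - ?y = - ?m" by (simp add: h power2_eq_square)
    hence "?m dvd ([:h:] - ?x\<^sup>2) - ?y" by (metis dvd_minus_iff dvd_refl)
    hence "?m dvd ([:h:] - ?x\<^sup>2) ^ j - ?y ^ j" for j
      by (subst power_diff_sumr2) (rule dvd_mult2)
    thus "?m dvd H ([:h:] - ?x\<^sup>2) - H ?y"
      by (auto simp: H_def simp flip: sum_subtractf smult_diff_right intro!: dvd_sum dvd_smult)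
  qed (rule W(2))
  finally show ?thesis by (simp add: c_def)
qed

section \<open>Euler-Maclaurin summation for complex powers\<close>

definition powr_deriv_coeff :: "nat \<Rightarrow> complex \<Rightarrow> complex" where
  "powr_deriv_coeff k s = (\<Prod>i<k. 1 - s - of_nat i) / (1 - s)"

text \<open>For positive \<open>k\<close> this is the coefficient of the \<open>(k - 1)\<close>-th derivative of \<open>x powr (-s)\<close>, and for
  \<open>k = 0\<close> that of its primitive.\<close>

lemma powr_deriv_coeff_Suc:
  "powr_deriv_coeff (Suc k) s = powr_deriv_coeff k s * (1 - s - of_nat k)"
  by (simp add: powr_deriv_coeff_def)

lemma powr_deriv_coeff_1 [simp]: "s \<noteq> 1 \<Longrightarrow> powr_deriv_coeff (Suc 0) s = 1"
  by (simp add: powr_deriv_coeff_def)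

lemma powr_deriv_coeff_holomorphic: "powr_deriv_coeff k holomorphic_on - {1}"
  unfolding powr_deriv_coeff_def by (auto intro!: holomorphic_intros)

text \<open>At \<open>s = -m\<close> the product is the falling factorial of \<open>m + 1\<close>,
  so the coefficient vanishes for \<open>k > m + 1\<close>.\<close>

lemma powr_deriv_coeff_neg_nat:
  "powr_deriv_coeff k (- of_nat m) = fact k * of_nat (Suc m choose k) / of_nat (Suc m)"
proof -
  have "(\<Prod>i<k. 1 - (- of_nat m) - of_nat i :: complex) = fact k * (of_nat (Suc m) gchoose k)"
    by (simp add: gbinomial_mult_fact add_ac atLeast0LessThan)
  thus ?thesis by (simp add: powr_deriv_coeff_def binomial_gbinomial add_ac)
qed

text \<open>An approximate antidifference of \<open>x powr (- s)\<close>: the term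
  \<open>k = 0\<close> is the integral and the others are the Bernoulli corrections.\<close>

definition euler_maclaurin_sum :: "nat \<Rightarrow> complex \<Rightarrow> complex \<Rightarrow> complex" where
  "euler_maclaurin_sum M s x =
     (\<Sum>k\<le>M. bernoulli_number k / fact k * powr_deriv_coeff k s * x powr (1 - s - of_nat k))"

definition euler_maclaurin_rem :: "nat \<Rightarrow> complex \<Rightarrow> complex \<Rightarrow> complex" where
  "euler_maclaurin_rem M s x =
     x powr (- s) - (euler_maclaurin_sum M s (x + 1) - euler_maclaurin_sum M s x)"

lemma bernpoly_egf_coeff_bounded:
  "\<exists>K\<ge>0. \<forall>t\<in>closed_segment 0 1. norm (bernpoly_egf_coeff k t) \<le> K"
proof -
  have "bernpoly_egf_coeff k field_differentiable (at t)" for t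
  proof (cases k)
    case 0
    hence "bernpoly_egf_coeff k = (\<lambda>_. 1)" by (simp add: fun_eq_iff)
    thus ?thesis by simp
  next
    case (Suc n)
    thus ?thesis using bernpoly_egf_coeff_deriv field_differentiable_def by blast
  qed
  hence "continuous_on (closed_segment 0 1) (bernpoly_egf_coeff k)"
    by (simp add: continuous_at_imp_continuous_on field_differentiable_imp_continuous_at)
  hence "bounded (bernpoly_egf_coeff k ` closed_segment 0 1)"
    by (intro compact_imp_bounded compact_continuous_image) auto
  thus ?thesis unfolding bounded_pos by (meson imageI less_imp_le)
qed

text \<open>The function \<open>\<Phi>\<close> in the proof is a primitive, up to sign, of the integrand of the classical
  Euler-Maclaurin remainder; the mean value inequality thus replaces the integral.\<close>

lemma norm_euler_maclaurin_rem_le: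
  assumes M: "M > 0" and s: "s \<noteq> 1" and x: "x > 0" and \<sigma>: "Re s + real M \<ge> 0"
    and K: "\<And>t. t \<in> closed_segment 0 1 \<Longrightarrow> norm (bernpoly_egf_coeff M t) \<le> K"
  shows "norm (euler_maclaurin_rem M s (of_real x))
           \<le> K * norm (powr_deriv_coeff (Suc M) s) * x powr (- Re s - real M)"
proof -
  let ?b = bernpoly_egf_coeff and ?c = powr_deriv_coeff
  let ?S = "closed_segment 0 1 :: complex set"
  \<comment> \<open>The base runs from \<open>x + 1\<close> at \<open>t = 0\<close> down to
    \<open>x\<close> at \<open>t = 1\<close>; the resulting minus sign in the derivative of
    \<open>g\<close> makes the sum \<Phi> telescope.\<close>
  define g where "g k t = ?c k s * (complex_of_real x + 1 - t) powr (1 - s - of_nat k)" for k t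
  define \<Phi> where "\<Phi> m t = (\<Sum>k\<le>m. ?b k t * g k t)" for m t
  \<comment> \<open>On the segment the base is real and at least \<open>x > 0\<close>, so it stays
    off the branch cut.\<close>
  have seg: "\<exists>u. complex_of_real x + 1 - t = of_real u \<and> x \<le> u" if "t \<in> ?S" for t
  proof -
    obtain v where "t = of_real v" "0 \<le> v" "v \<le> 1"
      using \<open>t \<in> ?S\<close> by (auto simp: in_segment scaleR_conv_of_real)
    thus ?thesis by (intro exI[of _ "x + 1 - v"]) auto
  qed
  have dg: "(g k has_field_derivative - g (Suc k) t) (at t)" if "t \<in> ?S" for k t
  proof -
    from seg[OF that] obtain u where u: "complex_of_real x + 1 - t = of_real u" "x \<le> u" by blast
    hence "complex_of_real x + 1 - t \<notin> \<real>\<^sub>\<le>\<^sub>0" using x by simp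
    thus ?thesis unfolding g_def
      by (auto intro!: derivative_eq_intros simp: powr_deriv_coeff_Suc algebra_simps)
  qed
  \<comment> \<open>By the product rule neighbouring terms cancel, leaving only the one from the top
    index.\<close>
  have d\<Phi>: "(\<Phi> m has_field_derivative - (?b m t * g (Suc m) t)) (at t)" if t: "t \<in> ?S" for m t
  proof (induction m)
    case 0
    show ?case using dg[OF t, of 0] by (simp add: \<Phi>_def)
  next
    case (Suc m)
    have "((\<lambda>t. \<Phi> m t + ?b (Suc m) t * g (Suc m) t) has_field_derivative
            - (?b m t * g (Suc m) t) + (?b m t * g (Suc m) t + - g (Suc (Suc m)) t * ?b (Suc m) t)) (at t)"
      by (intro DERIV_add DERIV_mult Suc.IH bernpoly_egf_coeff_deriv dg t)
    thus ?case by (simp add: \<Phi>_def mult.commute)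
  qed
  have "norm (\<Phi> M 1 - \<Phi> M 0) \<le> K * norm (?c (Suc M) s) * x powr (- Re s - real M) * norm (1 - 0 :: complex)"
  proof (rule field_differentiable_bound[where S = ?S])
    fix t assume t: "t \<in> ?S"
    show "(\<Phi> M has_field_derivative - (?b M t * g (Suc M) t)) (at t within ?S)"
      by (rule has_field_derivative_at_within[OF d\<Phi>[OF t]])
    from seg[OF t] obtain u where u: "complex_of_real x + 1 - t = of_real u" "x \<le> u" by blast
    have "norm (g (Suc M) t) = norm (?c (Suc M) s) * u powr (- Re s - real M)"
    proof -
      have "g (Suc M) t = ?c (Suc M) s * of_real u powr (- s - of_nat M)"
        unfolding g_def u(1) by simp
      thus ?thesis using x u(2) by (simp add: norm_mult norm_powr_real_powr)
    qed
    also have "\<dots> \<le> norm (?c (Suc M) s) * x powr (- Re s - real M)"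
      using x u(2) \<sigma> by (intro mult_left_mono powr_mono2') auto
    finally show "norm (- (?b M t * g (Suc M) t)) \<le> K * norm (?c (Suc M) s) * x powr (- Re s - real M)"
      using K[OF t] norm_ge_zero order_trans
      by (subst norm_minus_cancel, subst norm_mult, subst mult.assoc)
        (blast intro!: mult_mono)
  qed auto
  moreover have "\<Phi> M 1 - \<Phi> M 0 = euler_maclaurin_rem M s (of_real x)"
  proof -
    \<comment> \<open>The Bernoulli values at 1 and 0 differ only for \<open>k = 1\<close>, and
      there \<open>g 1 1\<close> is \<open>x powr (- s)\<close>.\<close>
    have "\<Phi> M 1 = (\<Sum>k\<le>M. ?b k 0 * g k 1) + (\<Sum>k\<le>M. if k = 1 then g 1 1 else 0)"
      unfolding \<Phi>_def sum.distrib[symmetric]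
      by (intro sum.cong) (auto simp: bernpoly_egf_coeff_1 algebra_simps)
    also have "(\<Sum>k\<le>M. if k = 1 then g 1 1 else 0) = of_real x powr (- s)"
      using s M by (simp add: g_def)
    finally show ?thesis
      by (simp add: \<Phi>_def euler_maclaurin_rem_def euler_maclaurin_sum_def g_def bernpoly_egf_coeff_0 mult.assoc)
  qed
  ultimately show ?thesis by simp
qed

section \<open>Continuation of zeta to the left of its half-plane of convergence\<close>

definition euler_maclaurin_zeta :: "nat \<Rightarrow> complex \<Rightarrow> complex" where
  "euler_maclaurin_zeta M s =
     - euler_maclaurin_sum M s 1 + (\<Sum>n. euler_maclaurin_rem M s (of_nat (Suc n)))"

lemma euler_maclaurin_rem_holomorphic:
  "(\<lambda>s. euler_maclaurin_rem M s (of_nat (Suc n))) holomorphic_on - {1}"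
  unfolding euler_maclaurin_rem_def euler_maclaurin_sum_def
  by (intro holomorphic_intros powr_deriv_coeff_holomorphic) auto

text \<open>The remainder at \<open>n\<close> is of order \<open>n powr (- Re s - M)\<close>, which
  is summable locally uniformly on this half-plane, so termwise differentiation applies.\<close>

lemma euler_maclaurin_rem_series:
  assumes M: "M > 0"
  defines "S \<equiv> {s. Re s > 1 - real M} - {1}"
  shows "(\<lambda>s. \<Sum>n. euler_maclaurin_rem M s (of_nat (Suc n))) holomorphic_on S"
    and "s \<in> S \<Longrightarrow> summable (\<lambda>n. euler_maclaurin_rem M s (of_nat (Suc n)))"
proof -
  let ?f = "\<lambda>n s. euler_maclaurin_rem M s (of_nat (Suc n))"
  have S: "open S"
    unfolding S_def by (intro open_Diff open_halfspace_Re_gt) auto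
  obtain K where "K \<ge> 0" and K: "\<And>t. t \<in> closed_segment 0 1 \<Longrightarrow> norm (bernpoly_egf_coeff M t) \<le> K"
    using bernpoly_egf_coeff_bounded by blast
  have "\<exists>g g'. \<forall>x\<in>S. (\<lambda>n. ?f n x) sums g x \<and> (\<lambda>n. deriv (?f n) x) sums g' x \<and>
                (g has_field_derivative g' x) (at x)"
  proof (rule series_and_derivative_comparison_local[OF S])
    fix n x assume "x \<in> S"
    thus "(?f n has_field_derivative deriv (?f n) x) (at x)"
      using euler_maclaurin_rem_holomorphic[of M n]
      by (intro holomorphic_derivI[of _ "- {1}"]) (auto simp: S_def)
  next
    fix x assume x: "x \<in> S"
    \<comment> \<open>Half the distance from \<open>x\<close> to the boundary line: within radius
      \<delta> the exponent stays at most \<open>- 1 - \<delta>\<close>.\<close>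
    define \<delta> where "\<delta> = (Re x + real M - 1) / 2"
    have \<delta>: "\<delta> > 0" using x by (simp add: \<delta>_def S_def)
    \<comment> \<open>By continuity, \<open>C\<close> bounds the coefficient near \<open>x\<close>;
      the added 1 is the tolerance used to choose \<open>d\<close>.\<close>
    define C where "C = norm (powr_deriv_coeff (Suc M) x) + 1"
    have "isCont (powr_deriv_coeff (Suc M)) x"
      using holomorphic_on_imp_differentiable_at[OF powr_deriv_coeff_holomorphic, of x "Suc M"] x
      by (intro field_differentiable_imp_continuous_at) (auto simp: S_def)
    then obtain d where d: "d > 0" "\<And>y. dist y x < d \<Longrightarrow>
        dist (powr_deriv_coeff (Suc M) y) (powr_deriv_coeff (Suc M) x) < 1"
      unfolding continuous_at_eps_delta using zero_less_one by blast
    have "norm (?f n y) \<le> K * C * real (Suc n) powr (- 1 - \<delta>)"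
      if y: "y \<in> ball x (min d \<delta>) \<inter> S" for n y
    proof -
      have "Re x - Re y \<le> dist x y"
        using complex_Re_le_cmod[of "x - y"] by (simp add: dist_norm)
      hence Re: "Re y + real M \<ge> 1 + \<delta>"
        using y by (auto simp: \<delta>_def field_simps)
      have "norm (?f n y) \<le> K * norm (powr_deriv_coeff (Suc M) y) * real (Suc n) powr (- Re y - real M)"
        using norm_euler_maclaurin_rem_le[OF M _ _ _ K, of y "real (Suc n)"] y Re \<delta>
        by (auto simp: S_def)
      also have "\<dots> \<le> K * C * real (Suc n) powr (- 1 - \<delta>)"
      proof (intro mult_mono powr_mono)
        show "norm (powr_deriv_coeff (Suc M) y) \<le> C"
          using d(2)[of y] y norm_triangle_ineq2[of "powr_deriv_coeff (Suc M) y" "powr_deriv_coeff (Suc M) x"]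
          by (simp add: C_def dist_norm norm_minus_commute)
      qed (use \<open>K \<ge> 0\<close> Re in \<open>auto simp: C_def\<close>)
      finally show ?thesis .
    qed
    moreover have "summable (\<lambda>n. real n powr (- 1 - \<delta>))"
      using \<delta> by (simp add: summable_real_powr_iff)
    hence "summable (\<lambda>n. K * C * real (Suc n) powr (- 1 - \<delta>))"
      by (intro summable_mult) (subst summable_Suc_iff)
    ultimately show "\<exists>d h. 0 < d \<and> summable h \<and> (\<forall>\<^sub>F n in sequentially. \<forall>y\<in>ball x d \<inter> S. norm (?f n y) \<le> h n)"
      using d(1) \<delta>
      by (intro exI[of _ "min d \<delta>"] exI[of _ "\<lambda>n. K * C * real (Suc n) powr (- 1 - \<delta>)"]) auto
  qed
  then obtain g g' where g: "\<And>x. x \<in> S \<Longrightarrow> (\<lambda>n. ?f n x) sums g x"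
      and g': "\<And>x. x \<in> S \<Longrightarrow> (g has_field_derivative g' x) (at x)"
    by blast
  show "s \<in> S \<Longrightarrow> summable (\<lambda>n. ?f n s)"
    using g sums_summable by blast
  have "g holomorphic_on S"
    using g' S by (auto simp: holomorphic_on_open)
  thus "(\<lambda>s. \<Sum>n. ?f n s) holomorphic_on S"
    by (rule holomorphic_transform) (use g sums_unique in blast)
qed

lemma euler_maclaurin_zeta_holomorphic:
  assumes "M > 0"
  shows "euler_maclaurin_zeta M holomorphic_on {s. Re s > 1 - real M} - {1}"
  unfolding euler_maclaurin_zeta_def euler_maclaurin_sum_def
  by (intro holomorphic_intros euler_maclaurin_rem_series(1) assms
      powr_deriv_coeff_holomorphic[THEN holomorphic_on_subset]) auto

text \<open>Raising the order subtracts increments of a null sequence \<open>G\<close> from the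
  remainders. They telescope to \<open>- G 0\<close>, which compensates the new term in the sum at
  1.\<close>

lemma euler_maclaurin_zeta_Suc:
  assumes M: "M > 0" and s: "s \<noteq> 1" "Re s > 1 - real M"
  shows "euler_maclaurin_zeta (Suc M) s = euler_maclaurin_zeta M s"
proof -
  define \<gamma> where "\<gamma> = bernoulli_number (Suc M) / fact (Suc M) * powr_deriv_coeff (Suc M) s"
  define G where "G n = \<gamma> * of_nat (Suc n) powr (1 - s - of_nat (Suc M))" for n
  have "(\<lambda>n. of_nat (Suc n) powr (1 - s - of_nat (Suc M))) \<longlonglongrightarrow> 0"
    using s by (intro tendsto_neg_powr_complex_of_nat filterlim_Suc) auto
  hence "G \<longlonglongrightarrow> 0"
    unfolding G_def by (rule tendsto_mult_right_zero)
  hence "(\<lambda>n. G (Suc n) - G n) sums (0 - G 0)"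
    by (rule telescope_sums)
  moreover have "(\<lambda>n. euler_maclaurin_rem M s (of_nat (Suc n))) sums
                   (\<Sum>n. euler_maclaurin_rem M s (of_nat (Suc n)))"
    using euler_maclaurin_rem_series(2)[OF M, of s] s by (intro summable_sums) auto
  ultimately have "(\<lambda>n. euler_maclaurin_rem M s (of_nat (Suc n)) - (G (Suc n) - G n)) sums
      ((\<Sum>n. euler_maclaurin_rem M s (of_nat (Suc n))) - (0 - G 0))"
    by (rule sums_diff[rotated])
  moreover have "euler_maclaurin_rem M s (of_nat (Suc n)) - (G (Suc n) - G n) =
                 euler_maclaurin_rem (Suc M) s (of_nat (Suc n))" for n
    by (simp add: euler_maclaurin_rem_def euler_maclaurin_sum_def G_def \<gamma>_def add_ac)
  ultimately have "(\<lambda>n. euler_maclaurin_rem (Suc M) s (of_nat (Suc n))) sums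
      ((\<Sum>n. euler_maclaurin_rem M s (of_nat (Suc n))) + G 0)"
    by simp
  moreover have "euler_maclaurin_sum (Suc M) s 1 = euler_maclaurin_sum M s 1 + G 0"
    by (simp add: euler_maclaurin_sum_def G_def \<gamma>_def)
  ultimately show ?thesis
    by (simp add: euler_maclaurin_zeta_def sums_iff)
qed

lemma euler_maclaurin_zeta_eq:
  assumes "M \<le> M'" "M > 0" "s \<noteq> 1" "Re s > 1 - real M"
  shows "euler_maclaurin_zeta M' s = euler_maclaurin_zeta M s"
  using assms(1)
proof (induction rule: dec_induct)
  case (step n)
  thus ?case using euler_maclaurin_zeta_Suc[of n s] assms(2-4) by simp
qed simp

text \<open>For \<open>Re s > 1\<close> every power in the antidifference tends to 0, so its
  increments telescope to minus its value at 1; adding the remainders recovers the Dirichlet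
  series.\<close>

lemma euler_maclaurin_zeta_sums:
  assumes M: "M > 0" and s: "Re s > 1"
  shows "(\<lambda>n. of_nat (Suc n) powr (- s)) sums euler_maclaurin_zeta M s"
proof -
  let ?P = "\<lambda>n. euler_maclaurin_sum M s (of_nat (Suc n))"
  have "s \<noteq> 1" using s by auto
  have "?P \<longlonglongrightarrow> (\<Sum>k\<le>M. bernoulli_number k / fact k * powr_deriv_coeff k s * 0)"
    unfolding euler_maclaurin_sum_def using s
    by (intro tendsto_intros tendsto_neg_powr_complex_of_nat filterlim_Suc) auto
  hence "(\<lambda>n. ?P (Suc n) - ?P n) sums (0 - ?P 0)"
    by (intro telescope_sums) simp
  moreover have "(\<lambda>n. euler_maclaurin_rem M s (of_nat (Suc n))) sums
                   (\<Sum>n. euler_maclaurin_rem M s (of_nat (Suc n)))"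
    using euler_maclaurin_rem_series(2)[OF M, of s] s \<open>s \<noteq> 1\<close> M by (intro summable_sums) auto
  ultimately have "(\<lambda>n. (?P (Suc n) - ?P n) + euler_maclaurin_rem M s (of_nat (Suc n))) sums
      ((0 - ?P 0) + (\<Sum>n. euler_maclaurin_rem M s (of_nat (Suc n))))"
    by (rule sums_add)
  thus ?thesis
    by (simp add: euler_maclaurin_rem_def euler_maclaurin_zeta_def add_ac)
qed

text \<open>The order varies with \<open>s\<close> so that one function covers the whole punctured
  plane. As the value does not depend on an admissible order, a fixed order can be used near each
  point to prove holomorphy.\<close>

lemma is_zeta_continuation_euler_maclaurin:
  "is_zeta_continuation (\<lambda>s. euler_maclaurin_zeta (Suc (nat \<lceil>1 - Re s\<rceil>)) s)"
    (is "is_zeta_continuation ?Z")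
  unfolding is_zeta_continuation_def
proof (intro conjI allI impI)
  have M: "Re s > 1 - real (Suc (nat \<lceil>1 - Re s\<rceil>))" for s :: complex
    using real_nat_ceiling_ge[of "1 - Re s"] by linarith
  have Z: "?Z s = euler_maclaurin_zeta M s" if "M > 0" "s \<noteq> 1" "Re s > 1 - real M" for M s
    using euler_maclaurin_zeta_eq[of M "Suc (nat \<lceil>1 - Re s\<rceil>)" s]
      euler_maclaurin_zeta_eq[of "Suc (nat \<lceil>1 - Re s\<rceil>)" M s] that M[of s]
    by (metis nle_le zero_less_Suc)
  show "?Z holomorphic_on - {1}"
    unfolding holomorphic_on_open[OF open_Compl[OF closed_singleton]]
  proof (intro ballI)
    fix z :: complex assume "z \<in> - {1}"
    define M where "M = Suc (nat \<lceil>1 - Re z\<rceil>)"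
    let ?S = "{s. Re s > 1 - real M} - {1}"
    have S: "open ?S" by (intro open_Diff open_halfspace_Re_gt) auto
    have "?Z holomorphic_on ?S"
      using euler_maclaurin_zeta_holomorphic[of M]
      by (rule holomorphic_transform) (use Z[of M] in \<open>auto simp: M_def\<close>)
    moreover have "z \<in> ?S" using \<open>z \<in> - {1}\<close> M[of z] by (simp add: M_def)
    ultimately show "\<exists>f'. (?Z has_field_derivative f') (at z)"
      using S holomorphic_on_open by blast
  qed
  show "(\<lambda>n. of_nat (Suc n) powr (- s)) sums ?Z s" if "Re s > 1" for s
    by (rule euler_maclaurin_zeta_sums) (use that in auto)
qed

text \<open>The explicit continuation shows that the choice in \<open>riemann_zeta\<close> has a
  witness; uniqueness then identifies the two off the pole.\<close>

lemma riemann_zeta_eq_euler_maclaurin: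
  assumes "s \<noteq> 1" "M > 0" "Re s > 1 - real M"
  shows "riemann_zeta s = euler_maclaurin_zeta M s"
proof -
  have "is_zeta_continuation riemann_zeta"
    unfolding riemann_zeta_def using is_zeta_continuation_euler_maclaurin by (rule someI[where P = is_zeta_continuation])
  hence "riemann_zeta s = euler_maclaurin_zeta (Suc (nat \<lceil>1 - Re s\<rceil>)) s"
    using is_zeta_continuation_unique[OF _ is_zeta_continuation_euler_maclaurin assms(1)] by blast
  moreover have "Re s > 1 - real (Suc (nat \<lceil>1 - Re s\<rceil>))"
    using real_nat_ceiling_ge[of "1 - Re s"] by linarith
  ultimately show ?thesis
    using euler_maclaurin_zeta_eq[of M "Suc (nat \<lceil>1 - Re s\<rceil>)" s]
      euler_maclaurin_zeta_eq[of "Suc (nat \<lceil>1 - Re s\<rceil>)" M s] assms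
    by (metis nle_le zero_less_Suc)
qed

section \<open>Zeta at the negative integers\<close>

lemma sum_binomial_bernoulli:
  assumes "N \<noteq> 1"
  shows "(\<Sum>k\<le>N. of_nat (N choose k) * bernoulli_number k) = bernoulli_number N"
proof -
  \<comment> \<open>The sum is \<open>B_N(1)\<close> read in reverse order; it equals
    \<open>B_N(0)\<close> except at \<open>N = 1\<close>.\<close>
  have "(\<Sum>k\<le>N. of_nat (N choose k) * bernoulli_number k) = scaled_bernpoly N 1 1"
    unfolding scaled_bernpoly_def atMost_atLeast0
    by (subst sum.atLeastAtMost_rev) (auto intro!: sum.cong simp flip: binomial_symmetric)
  also have "\<dots> = fact N * bernpoly_egf_coeff N 1"
    by (simp add: scaled_bernpoly_egf bernpoly_egf_coeff_def)
  also have "\<dots> = bernoulli_number N"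
    using assms by (simp add: bernpoly_egf_coeff_1 bernpoly_egf_coeff_0)
  finally show ?thesis .
qed

lemma riemann_zeta_neg_nat:
  assumes m: "m > 0"
  shows "riemann_zeta (- of_nat m) = - bernoulli_number (Suc m) / of_nat (Suc m)"
proof -
  \<comment> \<open>The order \<open>m + 2\<close> is the least whose half-plane contains
    \<open>-m\<close>; the coefficient bounding the remainder is already zero there.\<close>
  let ?s = "- of_nat m :: complex" and ?M = "Suc (Suc m)"
  have s: "?s \<noteq> 1"
    by (metis add.inverse_inverse of_nat_1 of_nat_add of_nat_eq_0_iff add_eq_0_iff add_is_0 one_neq_zero)
  have rem: "euler_maclaurin_rem ?M ?s (of_nat (Suc n)) = 0" for n
  proof -
    obtain K where K: "\<And>t. t \<in> closed_segment 0 1 \<Longrightarrow> norm (bernpoly_egf_coeff ?M t) \<le> K"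
      using bernpoly_egf_coeff_bounded by blast
    have "powr_deriv_coeff (Suc ?M) ?s = 0"
      by (subst powr_deriv_coeff_neg_nat) (simp add: binomial_eq_0 del: binomial_Suc_Suc)
    thus ?thesis
      using norm_euler_maclaurin_rem_le[OF _ s _ _ K, of "real (Suc n)"] by simp
  qed
  have "riemann_zeta ?s = euler_maclaurin_zeta ?M ?s"
    by (rule riemann_zeta_eq_euler_maclaurin[OF s]) auto
  also have "\<dots> = - euler_maclaurin_sum ?M ?s 1"
    by (simp add: euler_maclaurin_zeta_def rem del: of_nat_Suc)
  also have "euler_maclaurin_sum ?M ?s 1 =
               (\<Sum>k\<le>?M. of_nat (Suc m choose k) * bernoulli_number k) / of_nat (Suc m)"
    unfolding euler_maclaurin_sum_def sum_divide_distrib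
    by (intro sum.cong) (auto simp: powr_deriv_coeff_neg_nat simp del: of_nat_Suc)
  \<comment> \<open>The extra term \<open>k = m + 2\<close> has binomial coefficient 0.\<close>
  also have "(\<Sum>k\<le>?M. of_nat (Suc m choose k) * bernoulli_number k) =
               (\<Sum>k\<le>Suc m. of_nat (Suc m choose k) * bernoulli_number k)"
    by (subst sum.atMost_Suc) (simp add: binomial_eq_0 del: binomial_Suc_Suc)
  also have "\<dots> = bernoulli_number (Suc m)"
    by (rule sum_binomial_bernoulli) (use m in auto)
  finally show ?thesis by simp
qed

section \<open>From Bernoulli numbers to zeta values\<close>

theorem theorem3:
  fixes q w0 w1 h :: complex and V W a :: "nat \<Rightarrow> complex"
  assumes V0: "V 0 = 2" and V1: "V 1 = 1"
    and V_rec: "\<And>j. V (j + 2) = V (j + 1) - q * V j"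
    and W0: "W 0 = w0" and W1: "W 1 = w1"
    and W_rec: "\<And>j. W (j + 2) = W (j + 1) - q * W j"
    and h: "h = 1 - q"
    and a: "\<And>j. a j = W (2 * j) + W j - w0 * V j"
  shows "(\<forall>N::nat. even N \<and> N \<ge> 2 \<longrightarrow>
            (\<Sum>j=0..N. of_nat (N choose j) * h ^ (N - j) * bernoulli_number (N - j) * a j) = 0)
       \<and> (\<forall>N::nat. even N \<and> N \<ge> 4 \<longrightarrow>
            of_nat N * (\<Sum>j=1..N - 2. of_nat ((N - 1) choose j) * h ^ (N - j) * a j *
                          riemann_zeta (of_nat j + 1 - of_nat N))
            = a N - of_nat N * h / 2 * a (N - 1))"
proof -
  have 1: "(\<Sum>j=0..N. of_nat (N choose j) * h ^ (N - j) * bernoulli_number (N - j) * a j) = 0"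
    if "even N" for N
    by (rule sum_bernoulli_eq_0[OF V0 V1 V_rec W0 W_rec h a that])
  moreover have "of_nat N * (\<Sum>j=1..N - 2. of_nat ((N - 1) choose j) * h ^ (N - j) * a j *
                          riemann_zeta (of_nat j + 1 - of_nat N))
            = a N - of_nat N * h / 2 * a (N - 1)" if N: "even N" "N \<ge> 4" for N
  proof -
    let ?t = "\<lambda>j. of_nat (N choose j) * h ^ (N - j) * bernoulli_number (N - j) * a j"
    define n where "n = N - 2"
    have n: "N = Suc (Suc n)" using N by (simp add: n_def)
    \<comment> \<open>The absorption rule turns \<open>N * (N - 1 choose j)\<close> into
      \<open>(N - j) * (N choose j)\<close>, cancelling the denominator of the zeta value. For
      \<open>j \<le> N - 2\<close> the zeta argument is at most -1.\<close>
    have t: "of_nat N * (of_nat ((N - 1) choose j) * h ^ (N - j) * a j *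
                          riemann_zeta (of_nat j + 1 - of_nat N)) = - ?t j"
      if j: "j \<in> {1..n}" for j
    proof -
      have "of_nat j + 1 - of_nat N = (- of_nat (Suc n - j) :: complex)"
        using j by (simp add: n of_nat_diff algebra_simps)
      hence "riemann_zeta (of_nat j + 1 - of_nat N) = riemann_zeta (- of_nat (Suc n - j))"
        by simp
      also have "\<dots> = - bernoulli_number (N - j) / of_nat (N - j)"
        using j by (subst riemann_zeta_neg_nat) (auto simp: n Suc_diff_le)
      finally have z: "riemann_zeta (of_nat j + 1 - of_nat N) = - bernoulli_number (N - j) / of_nat (N - j)" .
      have "(N - j) * (N choose j) = N * ((N - 1) choose j)"
        using binomial_absorb_comp[of N j] by simp
      hence e: "of_nat (N - j) * of_nat (N choose j) = (of_nat N * of_nat ((N - 1) choose j) :: complex)"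
        by (metis of_nat_mult)
      have nz: "of_nat (N - j) \<noteq> (0 :: complex)" using j n by (simp only: of_nat_eq_0_iff) auto
      have "of_nat N * (of_nat ((N - 1) choose j) * h ^ (N - j) * a j *
               (- bernoulli_number (N - j) / of_nat (N - j))) =
            - ((of_nat N * of_nat ((N - 1) choose j)) / of_nat (N - j)) *
              (h ^ (N - j) * bernoulli_number (N - j) * a j)"
        by simp
      also have "(of_nat N * of_nat ((N - 1) choose j)) / of_nat (N - j) = (of_nat (N choose j) :: complex)"
        unfolding e[symmetric] using nz by simp
      finally show ?thesis unfolding z by (simp add: mult.assoc)
    qed
    have "0 = (\<Sum>j=0..N. ?t j)" using 1[OF N(1)] by simp
    \<comment> \<open>Three terms stay outside the zeta sum: \<open>j = 0\<close> vanishes since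
      \<open>a 0 = 0\<close>, while \<open>j = N - 1\<close> and \<open>j = N\<close> carry
      \<open>B_1\<close> and \<open>B_0\<close> and form the right-hand side.\<close>
    also have "\<dots> = ?t 0 + (\<Sum>j=1..n. ?t j) + ?t (Suc n) + ?t N"
      by (simp add: n sum.atLeast_Suc_atMost)
    also have "?t 0 = 0" by (simp add: a V0 W0)
    also have "?t (Suc n) = - (of_nat N * h / 2 * a (N - 1))"
      by (simp add: n bernoulli_number_1[unfolded One_nat_def])
    also have "?t N = a N" by (simp add: bernoulli_number_0)
    finally have "- (\<Sum>j=1..n. ?t j) = a N - of_nat N * h / 2 * a (N - 1)"
      by (simp add: algebra_simps eq_neg_iff_add_eq_0)
    moreover have "of_nat N * (\<Sum>j=1..N - 2. of_nat ((N - 1) choose j) * h ^ (N - j) * a j *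
                          riemann_zeta (of_nat j + 1 - of_nat N)) = - (\<Sum>j=1..n. ?t j)"
      unfolding sum_distrib_left sum_negf[symmetric] using t by (intro sum.cong) (auto simp: n)
    ultimately show ?thesis by simp
  qed
  ultimately show ?thesis by blast
qed

end
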